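(* Let $G$ be a non-nested spinal graph with $d$ non-slack edges, and let $\gamma$ be a total cyclic order on $\{0,1,\dots,d\}$. Then $\gamma$ is $G$-compatible if and only if it is a total cyclic extension of the partial cyclic order whose chains are $$(\max\mathrm{ACT}(j),\ \max\mathrm{ACT}(j)+1,\ \dots,\ j-1,\ j)\qquad\text{for } j\in[d].$$
   Context: Spinal graph: a directed multigraph $G$ on vertex set $[n+1]=\{1,\dots,n+1\}$, all of whose edges $(i,i')$ go from a smaller vertex $i$ (the tail) to a larger vertex $i'$ (the head), containing at least one edge $(i,i+1)$ for each $i=1,\dots,n$. For each $i$ exactly one of the edges $(i,i+1)$ is designated the slack edge $x_i$; all other edges are non-slack. The $d$ non-slack edges are labeled $y_1,\dots,y_d$ in canonical order: increasing lexicographic order of the pairs (tail, head), with parallel edges ordered arbitrarily. $G$ is non-nested if there are no two non-slack edges $(i,j)$, $(k,l)$ with $i<k<l<j$. Total cyclic order on a finite set $X$: a ternary relation $\gamma\subseteq X^3$ such that (a) $(x,y,z)\in\gamma\Rightarrow(y,z,x)\in\gamma$; (b) $(x,y,z)\in\gamma\Rightarrow(z,y,x)\notin\gamma$; (c) $(x,y,z),(x,z,u)\in\gamma\Rightarrow(x,y,u)\in\gamma$; (d) for all distinct $x,y,z$, $(x,y,z)\in\gamma$ or $(z,y,x)\in\gamma$. (A partial cyclic order satisfies (a)–(c).) A sequence $(j_1,\dots,j_m)$ is a chain in $\gamma$ if $(j_1,j_i,j_{i+1})\in\gamma$ for all $i=2,\dots,m-1$ (a two-element sequence imposes no condition). A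 total cyclic order $\gamma$ is a total cyclic extension of the partial cyclic order given by a set of chains if every sequence in the set is a chain in $\gamma$. For $j\in[d]$, an index $k\in[j]$ is active at $j$ if $\mathrm{head}(y_k)\le\mathrm{tail}(y_j)$ and inactive at $j$ otherwise; $\mathrm{ACT}(j)$ is the set of active indices at $j$ together with $0$, and $\mathrm{INACT}(j)$ the set of inactive indices at $j$. For a total cyclic order $\gamma$ on $\{0,1,\dots,d\}$ let $\mathrm{skip}(j)=|\{z\in\mathrm{ACT}(j):(j-1,z,j)\in\gamma\}|$. $\gamma$ is $G$-compatible (a $G$-cyclic order) if for all $j\in[d]$, $\sum_{k\in\mathrm{INACT}(j)}\mathrm{skip}(k)<|\mathrm{ACT}(j)|$. *)

theory Defs
  imports Main "Graph_Theory.Digraph"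
begin

section \<open>Spinal graphs\<close>

text \<open>Vertices are \<open>1, \<dots>, n + 1\<close>; \<open>x i\<close> is the slack edge designated among the
  (possibly several) parallel edges from \<open>i\<close> to \<open>i + 1\<close>.\<close>

definition non_slack :: "(nat, 'e) pre_digraph \<Rightarrow> nat \<Rightarrow> (nat \<Rightarrow> 'e) \<Rightarrow> 'e set" where
  "non_slack G n x = arcs G - x ` {1..n}"

locale spinal_graph = fin_digraph G
  for G :: "(nat, 'e) pre_digraph" +
  fixes n :: nat and x :: "nat \<Rightarrow> 'e"
  assumes verts_eq: "verts G = {1..n + 1}"
    and tail_less_head: "e \<in> arcs G \<Longrightarrow> tail G e < head G e"
    and slack_arc: "i \<in> {1..n} \<Longrightarrow> x i \<in> arcs G"
    and slack_ends: "i \<in> {1..n} \<Longrightarrow> arc_to_ends G (x i) = (i, i + 1)"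

text \<open>The labels \<open>1, \<dots>, d\<close> of the non-slack edges weakly increase in the lexicographic
  order of (tail, head), so that parallel edges may be labelled in any order.\<close>

definition canonical_labeling ::
  "(nat, 'e) pre_digraph \<Rightarrow> nat \<Rightarrow> (nat \<Rightarrow> 'e) \<Rightarrow> nat \<Rightarrow> (nat \<Rightarrow> 'e) \<Rightarrow> bool" where
  "canonical_labeling G n x d y \<longleftrightarrow>
     bij_betw y {1..d} (non_slack G n x) \<and>
     (\<forall>i\<in>{1..d}. \<forall>j\<in>{1..d}. i < j \<longrightarrow>
        tail G (y i) < tail G (y j) \<or>
        tail G (y i) = tail G (y j) \<and> head G (y i) \<le> head G (y j))"

definition non_nested :: "(nat, 'e) pre_digraph \<Rightarrow> nat \<Rightarrow> (nat \<Rightarrow> 'e) \<Rightarrow> bool" where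
  "non_nested G n x \<longleftrightarrow>
     \<not> (\<exists>e\<in>non_slack G n x. \<exists>f\<in>non_slack G n x.
          tail G e < tail G f \<and> tail G f < head G f \<and> head G f < head G e)"

section \<open>Cyclic orders\<close>

definition partial_cyclic_order :: "'a set \<Rightarrow> ('a \<times> 'a \<times> 'a) set \<Rightarrow> bool" where
  "partial_cyclic_order X \<gamma> \<longleftrightarrow>
     \<gamma> \<subseteq> X \<times> X \<times> X \<and>
     (\<forall>x y z. (x, y, z) \<in> \<gamma> \<longrightarrow> (y, z, x) \<in> \<gamma>) \<and>
     (\<forall>x y z. (x, y, z) \<in> \<gamma> \<longrightarrow> (z, y, x) \<notin> \<gamma>) \<and>
     (\<forall>x y z u. (x, y, z) \<in> \<gamma> \<and> (x, z, u) \<in> \<gamma> \<longrightarrow> (x, y, u) \<in> \<gamma>)"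

definition total_cyclic_order :: "'a set \<Rightarrow> ('a \<times> 'a \<times> 'a) set \<Rightarrow> bool" where
  "total_cyclic_order X \<gamma> \<longleftrightarrow>
     partial_cyclic_order X \<gamma> \<and>
     (\<forall>x\<in>X. \<forall>y\<in>X. \<forall>z\<in>X. x \<noteq> y \<and> y \<noteq> z \<and> x \<noteq> z \<longrightarrow>
        (x, y, z) \<in> \<gamma> \<or> (z, y, x) \<in> \<gamma>)"

text \<open>List positions start at \<open>0\<close>: for \<open>js = [j\<^sub>1, \<dots>, j\<^sub>m]\<close> the condition is
  \<open>(j\<^sub>1, j\<^sub>i, j\<^sub>i\<^sub>+\<^sub>1) \<in> \<gamma>\<close> for \<open>i = 2, \<dots>, m - 1\<close>.\<close>

definition cyclic_chain :: "('a \<times> 'a \<times> 'a) set \<Rightarrow> 'a list \<Rightarrow> bool" where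
  "cyclic_chain \<gamma> js \<longleftrightarrow>
     (\<forall>i. 1 \<le> i \<and> i + 1 < length js \<longrightarrow> (js ! 0, js ! i, js ! (i + 1)) \<in> \<gamma>)"

definition total_cyclic_extension ::
  "'a set \<Rightarrow> 'a list set \<Rightarrow> ('a \<times> 'a \<times> 'a) set \<Rightarrow> bool" where
  "total_cyclic_extension X C \<gamma> \<longleftrightarrow>
     total_cyclic_order X \<gamma> \<and> (\<forall>js\<in>C. cyclic_chain \<gamma> js)"

section \<open>Compatibility with a spinal graph\<close>

definition inactive :: "(nat, 'e) pre_digraph \<Rightarrow> (nat \<Rightarrow> 'e) \<Rightarrow> nat \<Rightarrow> nat set" where
  "inactive G y j = {k \<in> {1..j}. \<not> head G (y k) \<le> tail G (y j)}"

definition active :: "(nat, 'e) pre_digraph \<Rightarrow> (nat \<Rightarrow> 'e) \<Rightarrow> nat \<Rightarrow> nat set" where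
  "active G y j = insert 0 {k \<in> {1..j}. head G (y k) \<le> tail G (y j)}"

definition skip ::
  "(nat, 'e) pre_digraph \<Rightarrow> (nat \<Rightarrow> 'e) \<Rightarrow> (nat \<times> nat \<times> nat) set \<Rightarrow> nat \<Rightarrow> nat" where
  "skip G y \<gamma> j = card {z \<in> active G y j. (j - 1, z, j) \<in> \<gamma>}"

definition compatible ::
  "(nat, 'e) pre_digraph \<Rightarrow> nat \<Rightarrow> (nat \<Rightarrow> 'e) \<Rightarrow> (nat \<times> nat \<times> nat) set \<Rightarrow> bool" where
  "compatible G d y \<gamma> \<longleftrightarrow>
     (\<forall>j\<in>{1..d}. (\<Sum>k\<in>inactive G y j. skip G y \<gamma> k) < card (active G y j))"

end

theory Submission
  imports Defs
begin

text \<open>Non-nestedness makes the heads weakly increasing along the canonical labelling, so the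
  active set at \<open>j\<close> is \<open>{0..a j}\<close> with \<open>a\<close> weakly increasing and \<open>a j < j\<close>. View \<open>\<gamma>\<close> as an
  arrangement of \<open>0, \<dots>, d\<close> on a circle and walk \<open>a j \<rightarrow> a j + 1 \<rightarrow> \<dots> \<rightarrow> j\<close> clockwise: the sum of
  the skips counts passages over the points of \<open>{0..a j}\<close>. If the walk is a chain, it passes
  each point at most once and never passes \<open>a j\<close>, so the sum is at most \<open>a j\<close>. If \<open>j\<close> is minimal
  such that the walk is not a chain, then the last step completes a full turn, so every
  point of \<open>{0..a j}\<close> is passed; by minimality each passage at a step \<open>k\<close> is over a point of
  \<open>{0..a k}\<close> and hence counted, so the sum exceeds \<open>a j\<close>.\<close>

section \<open>Cyclic orders\<close>

lemma pco_rotate: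
  "\<lbrakk>partial_cyclic_order X \<gamma>; (x, y, z) \<in> \<gamma>\<rbrakk> \<Longrightarrow> (y, z, x) \<in> \<gamma>"
  unfolding partial_cyclic_order_def by blast

lemma pco_asym:
  "\<lbrakk>partial_cyclic_order X \<gamma>; (x, y, z) \<in> \<gamma>\<rbrakk> \<Longrightarrow> (z, y, x) \<notin> \<gamma>"
  unfolding partial_cyclic_order_def by blast

lemma pco_trans:
  "\<lbrakk>partial_cyclic_order X \<gamma>; (x, y, z) \<in> \<gamma>; (x, z, u) \<in> \<gamma>\<rbrakk> \<Longrightarrow> (x, y, u) \<in> \<gamma>"
  unfolding partial_cyclic_order_def by blast

lemma pco_distinct:
  assumes "partial_cyclic_order X \<gamma>" "(x, y, z) \<in> \<gamma>"
  shows "x \<noteq> y" "y \<noteq> z" "x \<noteq> z"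
  using assms unfolding partial_cyclic_order_def by blast+

text \<open>Moves the base point: the axiom composes triples with a fixed first entry, while later
  arguments must recut the circle at \<open>x\<close>. Rotated to begin with \<open>y\<close>, the
  two triples compose.\<close>

lemma pco_trans_right:
  assumes "partial_cyclic_order X \<gamma>" "(a, x, y) \<in> \<gamma>" "(a, y, z) \<in> \<gamma>"
  shows "(x, y, z) \<in> \<gamma>"
proof -
  have "(y, a, x) \<in> \<gamma>" using pco_rotate[OF assms(1) pco_rotate[OF assms(1,2)]] .
  moreover have "(y, z, a) \<in> \<gamma>" using pco_rotate[OF assms(1,3)] .
  ultimately have "(y, z, x) \<in> \<gamma>" by (rule pco_trans[OF assms(1), rotated])
  then show ?thesis by (rule pco_rotate[OF assms(1) pco_rotate[OF assms(1)]])
qed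

lemma total_cyclic_order_linear:
  assumes "total_cyclic_order X \<gamma>" "x \<in> X" "y \<in> X" "z \<in> X" "x \<noteq> y" "y \<noteq> z" "x \<noteq> z"
  shows "(x, y, z) \<in> \<gamma> \<or> (x, z, y) \<in> \<gamma>"
proof -
  have pco: "partial_cyclic_order X \<gamma>" using assms(1) unfolding total_cyclic_order_def by blast
  have "(x, y, z) \<in> \<gamma> \<or> (z, y, x) \<in> \<gamma>"
    using assms unfolding total_cyclic_order_def by blast
  moreover have "(x, z, y) \<in> \<gamma>" if "(z, y, x) \<in> \<gamma>"
    using that by (rule pco_rotate[OF pco pco_rotate[OF pco]])
  ultimately show ?thesis by blast
qed

section \<open>Chains of consecutive numbers\<close>

lemma cyclic_chain_upt_iff:
  "cyclic_chain \<gamma> [a..<j + 1] \<longleftrightarrow> (\<forall>i. a < i \<and> i < j \<longrightarrow> (a, i, i + 1) \<in> \<gamma>)"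
proof
  assume c: "cyclic_chain \<gamma> [a..<j + 1]"
  show "\<forall>i. a < i \<and> i < j \<longrightarrow> (a, i, i + 1) \<in> \<gamma>"
  proof (intro allI impI)
    fix i assume i: "a < i \<and> i < j"
    then have "1 \<le> i - a \<and> i - a + 1 < length [a..<j + 1]" by auto
    with c have "([a..<j+1] ! 0, [a..<j+1] ! (i - a), [a..<j+1] ! (i - a + 1)) \<in> \<gamma>"
      unfolding cyclic_chain_def by blast
    moreover have "[a..<j+1] ! 0 = a" "[a..<j+1] ! (i - a) = i" "[a..<j+1] ! (i - a + 1) = i + 1"
      using i by (auto simp del: upt_Suc)
    ultimately show "(a, i, i + 1) \<in> \<gamma>" by simp
  qed
next
  assume c: "\<forall>i. a < i \<and> i < j \<longrightarrow> (a, i, i + 1) \<in> \<gamma>"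
  show "cyclic_chain \<gamma> [a..<j + 1]"
    unfolding cyclic_chain_def
  proof (intro allI impI)
    fix i assume i: "1 \<le> i \<and> i + 1 < length [a..<j + 1]"
    then have "[a..<j+1] ! 0 = a" "[a..<j+1] ! i = a + i" "[a..<j+1] ! (i + 1) = a + i + 1"
      by (auto simp del: upt_Suc)
    moreover have "(a, a + i, a + i + 1) \<in> \<gamma>" using c i by (auto simp del: upt_Suc)
    ultimately show "([a..<j+1] ! 0, [a..<j+1] ! i, [a..<j+1] ! (i + 1)) \<in> \<gamma>" by simp
  qed
qed

text \<open>Cutting the circle at \<open>a\<close> turns \<open>(a, _, _)\<close> into a strict
  linear order, so the consecutive comparisons given by the chain compose by transitivity.\<close>

lemma chain_less:
  assumes "partial_cyclic_order X \<gamma>" "cyclic_chain \<gamma> [a..<j + 1]"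
    and "a < i" "i < k" "k \<le> j"
  shows "(a, i, k) \<in> \<gamma>"
  using assms(4,5)
proof (induction k)
  case (Suc k)
  have step: "(a, k, k + 1) \<in> \<gamma>" if "a < k"
    using assms(2) Suc.prems that unfolding cyclic_chain_upt_iff by simp
  show ?case
  proof (cases "i = k")
    case True
    then show ?thesis using step assms(3) by simp
  next
    case False
    then have "(a, i, k) \<in> \<gamma>" using Suc by simp
    moreover have "(a, k, Suc k) \<in> \<gamma>" using step \<open>i \<noteq> k\<close> Suc.prems assms(3) by simp
    ultimately show ?thesis by (rule pco_trans[OF assms(1)])
  qed
qed simp

text \<open>The numbers after \<open>a\<close> are linearly ordered once the circle is cut at
  \<open>a\<close>; recutting at a later member \<open>b\<close> keeps the order of those after
  \<open>b\<close>.\<close>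

lemma chain_suffix:
  assumes "partial_cyclic_order X \<gamma>" "cyclic_chain \<gamma> [a..<j + 1]" "a \<le> b"
  shows "cyclic_chain \<gamma> [b..<j + 1]"
  unfolding cyclic_chain_upt_iff
proof (intro allI impI)
  fix i assume i: "b < i \<and> i < j"
  show "(b, i, i + 1) \<in> \<gamma>"
  proof (cases "a = b")
    case True
    then show ?thesis using assms(2) i unfolding cyclic_chain_upt_iff by simp
  next
    case False
    then have "(a, b, i) \<in> \<gamma>" "(a, i, i + 1) \<in> \<gamma>"
      using chain_less[OF assms(1,2)] assms(3) i by auto
    then show ?thesis by (rule pco_trans_right[OF assms(1)])
  qed
qed

text \<open>Read \<open>(k - 1, z, k)\<close> as: the step from \<open>k - 1\<close> to
  \<open>k\<close> passes over \<open>z\<close>. Restarting the chain at the visited point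
  \<open>z\<close> puts \<open>k - 1\<close> before \<open>k\<close> in the order cut at
  \<open>z\<close>, so this step does not go round through \<open>z\<close>.\<close>

lemma chain_point_not_passed:
  assumes pco: "partial_cyclic_order X \<gamma>" and c: "cyclic_chain \<gamma> [a..<j + 1]"
    and "a \<le> z" "z < k" "k \<le> j"
  shows "(k - 1, z, k) \<notin> \<gamma>"
proof (cases "z = k - 1")
  case True
  then show ?thesis using pco_distinct[OF pco] by blast
next
  case False
  have "(z, k - 1, k) \<in> \<gamma>"
    using chain_less[OF pco chain_suffix[OF pco c \<open>a \<le> z\<close>], of "k - 1" k] False assms by auto
  then have "(k, z, k - 1) \<in> \<gamma>" by (rule pco_rotate[OF pco pco_rotate[OF pco]])
  then show ?thesis by (rule pco_asym[OF pco])
qed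

text \<open>Along a chain no step crosses the cut at \<open>a\<close>, so a passed point lies
  between the ends of its step in the linear order from \<open>a\<close>. The lower bound needs
  \<open>a < k - 1\<close>, since a first step starts at the cut itself.\<close>

lemma chain_passed_cut:
  assumes pco: "partial_cyclic_order X \<gamma>" and c: "cyclic_chain \<gamma> [a..<j + 1]"
    and k: "a < k" "k \<le> j" and p: "(k - 1, z, k) \<in> \<gamma>"
  shows "(a, z, k) \<in> \<gamma>" "a < k - 1 \<Longrightarrow> (a, k - 1, z) \<in> \<gamma>"
proof -
  have le: "(a, k - 1, k) \<in> \<gamma>" if "a < k - 1"
    using chain_less[OF pco c that] k by simp
  show "(a, z, k) \<in> \<gamma>"
  proof (cases "a = k - 1")
    case True
    then show ?thesis using p by simp
  next
    case False
    then have "(a, k - 1, k) \<in> \<gamma>" using le k by simp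
    then have "(k, a, k - 1) \<in> \<gamma>" by (rule pco_rotate[OF pco pco_rotate[OF pco]])
    moreover have "(k, k - 1, z) \<in> \<gamma>" by (rule pco_rotate[OF pco pco_rotate[OF pco p]])
    ultimately have "(k, a, z) \<in> \<gamma>" by (rule pco_trans[OF pco])
    then show ?thesis by (rule pco_rotate[OF pco])
  qed
  show "(a, k - 1, z) \<in> \<gamma>" if "a < k - 1"
  proof -
    have "(k - 1, k, a) \<in> \<gamma>" by (rule pco_rotate[OF pco le[OF that]])
    with p have "(k - 1, z, a) \<in> \<gamma>" by (rule pco_trans[OF pco])
    then show ?thesis by (rule pco_rotate[OF pco pco_rotate[OF pco]])
  qed
qed

text \<open>In the linear order from \<open>a\<close>, different steps span disjoint intervals: a
  \<open>z\<close> passed twice would lie before \<open>k\<close>, hence before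
  \<open>l - 1\<close>, and also after \<open>l - 1\<close>.\<close>

lemma chain_passed_once:
  assumes pco: "partial_cyclic_order X \<gamma>" and c: "cyclic_chain \<gamma> [a..<j + 1]"
    and k: "a < k" "k < l" "l \<le> j"
    and p: "(k - 1, z, k) \<in> \<gamma>"
  shows "(l - 1, z, l) \<notin> \<gamma>"
proof
  assume q: "(l - 1, z, l) \<in> \<gamma>"
  have zk: "(a, z, k) \<in> \<gamma>"
    using chain_passed_cut(1)[OF pco c _ _ p] k by simp
  have lz: "(a, l - 1, z) \<in> \<gamma>"
    using chain_passed_cut(2)[OF pco c _ _ q] k by simp
  have "(a, z, l - 1) \<in> \<gamma>"
  proof (cases "k = l - 1")
    case True
    then show ?thesis using zk by simp
  next
    case False
    then have "(a, k, l - 1) \<in> \<gamma>" using chain_less[OF pco c] k by simp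
    with zk show ?thesis by (rule pco_trans[OF pco])
  qed
  then have "(z, l - 1, a) \<in> \<gamma>" by (rule pco_rotate[OF pco])
  with pco_asym[OF pco lz] show False by blast
qed

text \<open>A discrete intermediate value argument. The turning step itself passes \<open>a\<close>.
  If \<open>z < a\<close> were never passed, all of \<open>a + 1\<close>, ..., \<open>j - 1\<close>
  would stay before \<open>z\<close> in the order cut at \<open>a\<close>, and the last step, which
  goes on past \<open>a\<close>, would have to pass \<open>z\<close>.\<close>

lemma full_turn_passes_all:
  fixes a d j z :: nat
  assumes tco: "total_cyclic_order {0..d} \<gamma>"
    and turn: "(j - 1, a, j) \<in> \<gamma>" and j: "a < j" "j \<le> d" and z: "z \<le> a"
  shows "\<exists>k\<in>{a<..j}. (k - 1, z, k) \<in> \<gamma>"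
proof (rule ccontr)
  assume "\<not> ?thesis"
  then have none: "(k - 1, z, k) \<notin> \<gamma>" if "a < k" "k \<le> j" for k using that by auto
  have pco: "partial_cyclic_order {0..d} \<gamma>" using tco unfolding total_cyclic_order_def by blast
  have "z \<noteq> a" using none[OF j(1) le_refl] turn by auto
  then have za: "z < a" using z by simp
  have cut: "(a, k, z) \<in> \<gamma> \<or> (a, z, k) \<in> \<gamma>" if "a < k" "k \<le> j" for k
    using total_cyclic_order_linear[OF tco, of a k z] za that j by auto
  have before: "(a, k, z) \<in> \<gamma>" if "a + 1 \<le> k" "k \<le> j - 1" for k
    using that
  proof (induction k rule: dec_induct)
    case base
    then have "a < a + 1" "a + 1 \<le> j" using j by auto
    from none[OF this] cut[OF this] show ?case by simp
  next
    case (step k)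
    then have k: "(a, k, z) \<in> \<gamma>" "a < Suc k" "Suc k \<le> j" by auto
    have "(k, z, Suc k) \<notin> \<gamma>" using none[OF k(2,3)] by simp
    then have "(a, z, Suc k) \<notin> \<gamma>" using pco_trans_right[OF pco k(1)] by blast
    then show ?case using cut[OF k(2,3)] by blast
  qed
  have "j - 1 \<noteq> a" using pco_distinct[OF pco turn] by blast
  then have "(a, j - 1, z) \<in> \<gamma>" using before[of "j - 1"] j by linarith
  then have "(j - 1, z, a) \<in> \<gamma>" by (rule pco_rotate[OF pco])
  then have "(j - 1, z, j) \<in> \<gamma>" using turn by (rule pco_trans[OF pco])
  then show False using none[OF j(1) le_refl] by blast
qed

section \<open>Counting skips\<close>

lemma skips_le_if_chain:
  fixes a :: "nat \<Rightarrow> nat"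
  assumes pco: "partial_cyclic_order X \<gamma>" and c: "cyclic_chain \<gamma> [a j..<j + 1]"
    and mono: "\<And>k. k \<in> {a j<..j} \<Longrightarrow> a k \<le> a j"
  shows "(\<Sum>k\<in>{a j<..j}. card {z \<in> {0..a k}. (k - 1, z, k) \<in> \<gamma>}) \<le> a j"
proof -
  define S where "S k = {z \<in> {0..a k}. (k - 1, z, k) \<in> \<gamma>}" for k
  have disj: "S k \<inter> S l = {}" if "k \<in> {a j<..j}" "l \<in> {a j<..j}" "k < l" for k l
  proof -
    have "a j < k" "l \<le> j" using that by auto
    then have "(l - 1, z, l) \<notin> \<gamma>" if "(k - 1, z, k) \<in> \<gamma>" for z
      using chain_passed_once[OF pco c] \<open>k < l\<close> that by blast
    then show ?thesis unfolding S_def by blast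
  qed
  \<comment> \<open>The start \<open>a j\<close> is a visited point, hence never passed; excluding
    it lowers the bound from \<open>a j + 1\<close> to \<open>a j\<close>.\<close>
  have sub: "(\<Union>k\<in>{a j<..j}. S k) \<subseteq> {..<a j}"
  proof
    fix z assume "z \<in> (\<Union>k\<in>{a j<..j}. S k)"
    then obtain k where k: "k \<in> {a j<..j}" "z \<le> a k" "(k - 1, z, k) \<in> \<gamma>"
      unfolding S_def by auto
    have "z \<noteq> a j" using chain_point_not_passed[OF pco c, of "a j" k] k by auto
    then show "z \<in> {..<a j}" using k mono[of k] by simp
  qed
  have "(\<Sum>k\<in>{a j<..j}. card (S k)) = card (\<Union>k\<in>{a j<..j}. S k)"
  proof (rule card_UN_disjoint[symmetric])
    show "\<forall>k\<in>{a j<..j}. \<forall>l\<in>{a j<..j}. k \<noteq> l \<longrightarrow> S k \<inter> S l = {}"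
    proof (intro ballI impI)
      fix k l assume "k \<in> {a j<..j}" "l \<in> {a j<..j}" "k \<noteq> l"
      then show "S k \<inter> S l = {}"
        using disj[of k l] disj[of l k] by (metis Int_commute linorder_neqE_nat)
    qed
  qed (auto simp: S_def)
  also have "\<dots> \<le> card {..<a j}" by (rule card_mono[OF _ sub]) simp
  finally show ?thesis unfolding S_def by simp
qed

lemma chain_if_skips_le:
  fixes a :: "nat \<Rightarrow> nat"
  assumes tco: "total_cyclic_order {0..d} \<gamma>"
    and mono: "\<And>k l. \<lbrakk>1 \<le> k; k \<le> l; l \<le> d\<rbrakk> \<Longrightarrow> a k \<le> a l"
    and less: "\<And>k. \<lbrakk>1 \<le> k; k \<le> d\<rbrakk> \<Longrightarrow> a k < k"
    and skips: "\<And>j. \<lbrakk>1 \<le> j; j \<le> d\<rbrakk> \<Longrightarrow>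
      (\<Sum>k\<in>{a j<..j}. card {z \<in> {0..a k}. (k - 1, z, k) \<in> \<gamma>}) \<le> a j"
    and "1 \<le> j" "j \<le> d"
  shows "cyclic_chain \<gamma> [a j..<j + 1]"
  using \<open>1 \<le> j\<close> \<open>j \<le> d\<close>
proof (induction j rule: less_induct)
  case (less j)
  have pco: "partial_cyclic_order {0..d} \<gamma>" using tco unfolding total_cyclic_order_def by blast
  have aj: "a j < j" using assms(3) less.prems by simp
  show ?case
  proof (cases "a j = j - 1")
    case True
    then show ?thesis unfolding cyclic_chain_upt_iff by auto
  next
    case False
    then have aj': "a j < j - 1" using aj by simp
    \<comment> \<open>The walk for \<open>j - 1\<close> starts no later than \<open>a j\<close>, so
      its tail settles everything except the last triple.\<close>
    have "cyclic_chain \<gamma> [a (j - 1)..<j - 1 + 1]"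
      using less.IH[of "j - 1"] less.prems aj' by linarith
    moreover have "a (j - 1) \<le> a j" using mono[of "j - 1" j] aj' less.prems by simp
    ultimately have c: "cyclic_chain \<gamma> [a j..<j - 1 + 1]" by (rule chain_suffix[OF pco])
    have last: "(a j, j - 1, j) \<in> \<gamma>"
    proof (rule ccontr)
      assume "(a j, j - 1, j) \<notin> \<gamma>"
      then have "(a j, j, j - 1) \<in> \<gamma>"
        using total_cyclic_order_linear[OF tco, of "a j" "j - 1" j] aj' less.prems by auto
      then have turn: "(j - 1, a j, j) \<in> \<gamma>" by (rule pco_rotate[OF pco pco_rotate[OF pco]])
      define S where "S k = {z \<in> {0..a k}. (k - 1, z, k) \<in> \<gamma>}" for k
      \<comment> \<open>Covering these \<open>a j + 1\<close> points by the counted sets contradicts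
        the bound \<open>a j\<close> on the sum of their sizes.\<close>
      have "{0..a j} \<subseteq> (\<Union>k\<in>{a j<..j}. S k)"
      proof
        fix z assume z: "z \<in> {0..a j}"
        obtain k where k: "k \<in> {a j<..j}" "(k - 1, z, k) \<in> \<gamma>"
          using full_turn_passes_all[OF tco turn aj less.prems(2), of z] z by auto
        \<comment> \<open>A passage is counted only up to \<open>a k\<close>. For
          \<open>k < j\<close>, a point \<open>z\<close> with \<open>a k < z\<close> has been
          visited by the walk for \<open>k\<close>, since \<open>z \<le> a j < k\<close>, so step
          \<open>k\<close> could not pass it.\<close>
        have "z \<le> a k"
        proof (cases "k = j")
          case True
          then show ?thesis using z by simp
        next
          case False
          then have "cyclic_chain \<gamma> [a k..<k + 1]"
            using less.IH[of k] less.prems k by simp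
          from chain_point_not_passed[OF pco this, of z k] show ?thesis
            using k z by (cases "a k \<le> z") auto
        qed
        then show "z \<in> (\<Union>k\<in>{a j<..j}. S k)" using k unfolding S_def by auto
      qed
      then have "card {0..a j} \<le> card (\<Union>k\<in>{a j<..j}. S k)"
        by (intro card_mono) (auto simp: S_def)
      also have "\<dots> \<le> (\<Sum>k\<in>{a j<..j}. card (S k))" by (rule card_UN_le) simp
      also have "\<dots> \<le> a j" using skips less.prems unfolding S_def by simp
      finally show False by simp
    qed
    show ?thesis
      unfolding cyclic_chain_upt_iff
    proof (intro allI impI)
      fix i assume i: "a j < i \<and> i < j"
      show "(a j, i, i + 1) \<in> \<gamma>"
      proof (cases "i = j - 1")
        case True
        then show ?thesis using last i by simp
      next
        case False
        then have "a j < i \<and> i < j - 1" using i by linarith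
        then show ?thesis using c unfolding cyclic_chain_upt_iff by blast
      qed
    qed
  qed
qed

section \<open>Active sets of non-nested spinal graphs\<close>

lemma canonical_labeling_non_slack:
  assumes "canonical_labeling G n x d y" "1 \<le> k" "k \<le> d"
  shows "y k \<in> non_slack G n x"
proof -
  have "bij_betw y {1..d} (non_slack G n x)"
    using assms(1) unfolding canonical_labeling_def by blast
  then show ?thesis using assms(2,3) by (auto dest: bij_betwE)
qed

lemma canonical_labeling_lex:
  assumes "canonical_labeling G n x d y" "1 \<le> k" "k < l" "l \<le> d"
  shows "tail G (y k) < tail G (y l) \<or>
    tail G (y k) = tail G (y l) \<and> head G (y k) \<le> head G (y l)"
proof -
  have "k \<in> {1..d}" "l \<in> {1..d}" using assms(2-4) by auto
  with assms(1,3) show ?thesis unfolding canonical_labeling_def by blast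
qed

lemma canonical_labeling_tail_mono:
  assumes "canonical_labeling G n x d y" "1 \<le> k" "k \<le> l" "l \<le> d"
  shows "tail G (y k) \<le> tail G (y l)"
proof (cases "k = l")
  case False
  then show ?thesis using canonical_labeling_lex[OF assms(1,2), of l] assms(3,4) by auto
qed simp

text \<open>Labels are sorted by tail and then by head, so a drop in the head forces a strictly
  smaller tail, and the later edge would be nested in the earlier one.\<close>

lemma non_nested_head_mono:
  assumes sp: "spinal_graph G n x" and lab: "canonical_labeling G n x d y"
    and nn: "non_nested G n x" and kl: "1 \<le> k" "k \<le> l" "l \<le> d"
  shows "head G (y k) \<le> head G (y l)"
proof (cases "k = l")
  case False
  have mem: "y k \<in> non_slack G n x" "y l \<in> non_slack G n x"
    using canonical_labeling_non_slack[OF lab] kl by simp_all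
  then have "tail G (y l) < head G (y l)"
    using spinal_graph.tail_less_head[OF sp] unfolding non_slack_def by simp
  with mem nn have "\<not> (tail G (y k) < tail G (y l) \<and> head G (y l) < head G (y k))"
    unfolding non_nested_def by blast
  moreover have "tail G (y k) < tail G (y l) \<or> head G (y k) \<le> head G (y l)"
    using canonical_labeling_lex[OF lab, of k l] kl False by auto
  ultimately show ?thesis by linarith
qed simp

lemma active_Max_less:
  assumes sp: "spinal_graph G n x" and lab: "canonical_labeling G n x d y"
    and j: "1 \<le> j" "j \<le> d"
  shows "Max (active G y j) < j"
proof -
  have "y j \<in> arcs G"
    using canonical_labeling_non_slack[OF lab j] unfolding non_slack_def by blast
  then have "tail G (y j) < head G (y j)" by (rule spinal_graph.tail_less_head[OF sp])
  then have "j \<notin> active G y j" using j by (simp add: active_def)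
  moreover have "active G y j \<subseteq> {0..j}" by (auto simp: active_def)
  ultimately have "i < j" if "i \<in> active G y j" for i
    using that by (metis atLeastAtMost_iff le_neq_implies_less subsetD)
  moreover have "finite (active G y j)" "active G y j \<noteq> {}" by (simp_all add: active_def)
  ultimately show ?thesis by simp
qed

text \<open>Weakly increasing heads make activity inherited by smaller positive labels, and
  \<open>0\<close> belongs to the set by convention, so the set is an initial segment.\<close>

lemma non_nested_active_eq:
  assumes sp: "spinal_graph G n x" and lab: "canonical_labeling G n x d y"
    and nn: "non_nested G n x" and j: "1 \<le> j" "j \<le> d"
  shows "active G y j = {0..Max (active G y j)}"
proof -
  have fin: "finite (active G y j)" "active G y j \<noteq> {}" by (simp_all add: active_def)
  have down: "i \<in> active G y j" if m: "m \<in> active G y j" and i: "i \<le> m" for i m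
  proof (cases "i = 0")
    case True
    then show ?thesis by (simp add: active_def)
  next
    case False
    then have m': "m \<le> j" "head G (y m) \<le> tail G (y j)" using m i by (auto simp: active_def)
    have "head G (y i) \<le> head G (y m)"
      using non_nested_head_mono[OF sp lab nn _ i] False m'(1) j(2) by simp
    then show ?thesis using False i m' by (simp add: active_def)
  qed
  show ?thesis
  proof (intro equalityI subsetI)
    fix i assume "i \<in> active G y j"
    then show "i \<in> {0..Max (active G y j)}" using Max_ge[OF fin(1)] by simp
  next
    fix i assume "i \<in> {0..Max (active G y j)}"
    then have "i \<le> Max (active G y j)" by simp
    then show "i \<in> active G y j" by (rule down[OF Max_in[OF fin]])
  qed
qed

lemma active_mono:
  assumes "canonical_labeling G n x d y" "1 \<le> k" "k \<le> l" "l \<le> d"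
  shows "active G y k \<subseteq> active G y l"
proof
  fix i assume "i \<in> active G y k"
  then show "i \<in> active G y l"
    using canonical_labeling_tail_mono[OF assms] assms(3) by (cases "i = 0") (simp_all add: active_def)
qed

theorem proposition5p8:
  fixes G :: "(nat, 'e) pre_digraph"
    and n d :: nat
    and x y :: "nat \<Rightarrow> 'e"
    and \<gamma> :: "(nat \<times> nat \<times> nat) set"
  assumes "spinal_graph G n x"
    and "canonical_labeling G n x d y"
    and "non_nested G n x"
    and "total_cyclic_order {0..d} \<gamma>"
  shows "compatible G d y \<gamma> \<longleftrightarrow>
    total_cyclic_extension {0..d}
      ((\<lambda>j. [Max (active G y j)..<j + 1]) ` {1..d}) \<gamma>"
proof -
  define a where "a j = Max (active G y j)" for j
  have pco: "partial_cyclic_order {0..d} \<gamma>"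
    using assms(4) unfolding total_cyclic_order_def by blast
  have act: "active G y j = {0..a j}" if "1 \<le> j" "j \<le> d" for j
    using non_nested_active_eq[OF assms(1-3) that] unfolding a_def .
  have less: "a j < j" if "1 \<le> j" "j \<le> d" for j
    using active_Max_less[OF assms(1,2) that] unfolding a_def .
  have mono: "a k \<le> a l" if "1 \<le> k" "k \<le> l" "l \<le> d" for k l
    unfolding a_def
    by (rule Max_mono[OF active_mono[OF assms(2) that]]) (simp_all add: active_def)
  have inact: "inactive G y j = {a j<..j}" if "1 \<le> j" "j \<le> d" for j
  proof -
    have "inactive G y j = {1..j} - active G y j" by (auto simp: active_def inactive_def)
    then show ?thesis using act[OF that] by auto
  qed
  have skip: "skip G y \<gamma> k = card {z \<in> {0..a k}. (k - 1, z, k) \<in> \<gamma>}" if "1 \<le> k" "k \<le> d" for k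
    using act[OF that] unfolding skip_def by simp
  \<comment> \<open>The strict bound becomes a weak one because \<open>{0..a j}\<close> has
    \<open>a j + 1\<close> elements.\<close>
  have sum: "(\<Sum>k\<in>inactive G y j. skip G y \<gamma> k) < card (active G y j) \<longleftrightarrow>
      (\<Sum>k\<in>{a j<..j}. card {z \<in> {0..a k}. (k - 1, z, k) \<in> \<gamma>}) \<le> a j" if "1 \<le> j" "j \<le> d" for j
  proof -
    have "(\<Sum>k\<in>inactive G y j. skip G y \<gamma> k) =
        (\<Sum>k\<in>{a j<..j}. card {z \<in> {0..a k}. (k - 1, z, k) \<in> \<gamma>})"
      unfolding inact[OF that] by (rule sum.cong[OF refl skip]) (use that in simp_all)
    then show ?thesis unfolding act[OF that] by (simp only: card_atLeastAtMost less_Suc_eq_le diff_zero)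
  qed
  have "compatible G d y \<gamma> \<longleftrightarrow> (\<forall>j\<in>{1..d}. cyclic_chain \<gamma> [a j..<j + 1])"
  proof
    assume comp: "compatible G d y \<gamma>"
    have skips: "(\<Sum>k\<in>{a j<..j}. card {z \<in> {0..a k}. (k - 1, z, k) \<in> \<gamma>}) \<le> a j"
      if j: "1 \<le> j" "j \<le> d" for j
    proof -
      have "j \<in> {1..d}" using j by simp
      with comp sum[OF j] show ?thesis unfolding compatible_def by blast
    qed
    show "\<forall>j\<in>{1..d}. cyclic_chain \<gamma> [a j..<j + 1]"
    proof
      fix j assume "j \<in> {1..d}"
      then have "1 \<le> j" "j \<le> d" by auto
      with assms(4) mono less skips show "cyclic_chain \<gamma> [a j..<j + 1]"
        by (rule chain_if_skips_le)
    qed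
  next
    assume c: "\<forall>j\<in>{1..d}. cyclic_chain \<gamma> [a j..<j + 1]"
    show "compatible G d y \<gamma>"
      unfolding compatible_def
    proof
      fix j assume jd: "j \<in> {1..d}"
      then have j: "1 \<le> j" "j \<le> d" by auto
      have "a k \<le> a j" if "k \<in> {a j<..j}" for k
        using that j by (intro mono) auto
      with pco bspec[OF c jd]
      show "(\<Sum>k\<in>inactive G y j. skip G y \<gamma> k) < card (active G y j)"
        unfolding sum[OF j] by (rule skips_le_if_chain)
    qed
  qed
  then show ?thesis
    using assms(4) unfolding total_cyclic_extension_def a_def by (simp del: upt_Suc)
qed

end
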